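(* Let $\mathcal{C}\subseteq\mathbb{Z}_2^\alpha\times\mathbb{Z}_4^\beta$ be a $\mathbb{Z}_2\mathbb{Z}_4$-additive code such that $4\mid N_{1,1}(\mathbf w,\mathbf y)$ for any codewords $(\mathbf v|\mathbf w),(\mathbf x|\mathbf y)\in\mathcal{C}$. If $\mathcal{C}$ is self-orthogonal, then $\theta^{-1}(\mathcal{C})$ is also a self-orthogonal code over $\mathbb{Z}_2R$. Furthermore, if $\mathcal{C}$ is self-dual, then $\theta^{-1}(\mathcal{C})$ is also a self-dual code over $\mathbb{Z}_2R$.
   Context: Let $R=\mathbb{Z}_2+u\mathbb{Z}_2=\{0,1,u,1+u\}$ with $u^2=0$. A $\mathbb{Z}_2\mathbb{Z}_4$-additive code is a subgroup of $\mathbb{Z}_2^\alpha\times\mathbb{Z}_4^\beta$. On $\mathbb{Z}_2^\alpha\times R^\beta$ the inner product is $\langle(\mathbf v|\mathbf w),(\mathbf x|\mathbf y)\rangle=u\sum_{i=1}^\alpha v_ix_i+\sum_{j=1}^\beta w_jy_j\in R$. On $\mathbb{Z}_2^\alpha\times\mathbb{Z}_4^\beta$ the inner product is $\langle(\mathbf v|\mathbf w),(\mathbf x|\mathbf y)\rangle=2\sum_{i=1}^\alpha v_ix_i+\sum_{j=1}^\beta w_jy_j\in\mathbb{Z}_4$. In both settings $\mathcal{C}^\perp$ is the set of vectors orthogonal to all of $\mathcal{C}$; $\mathcal{C}$ is self-orthogonal if $\mathcal{C}\subseteq\mathcal{C}^\perp$ and self-dual if $\mathcal{C}=\mathcal{C}^\perp$.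 The bijection $\theta:\mathbb{Z}_2^\alpha\times R^\beta\to\mathbb{Z}_2^\alpha\times\mathbb{Z}_4^\beta$ is $\theta(\mathbf v|\mathbf w)=(\mathbf v|\theta(w_1),\dots,\theta(w_\beta))$ with $\theta(0)=0$, $\theta(1)=1$, $\theta(u)=2$, $\theta(1+u)=3$. For $\mathbf w,\mathbf y\in\mathbb{Z}_4^\beta$, $N_{1,1}(\mathbf w,\mathbf y)$ is the number of indices $i$ such that both $w_i$ and $y_i$ are units (i.e. in $\{1,3\}$). *)

theory Defs
  imports
    "HOL-Algebra.Product_Groups"
    "HOL-Library.Numeral_Type"
    "HOL-Library.Z2"
begin

text \<open>
  The ring \<open>R = Z\<^sub>2 + u Z\<^sub>2\<close> with \<open>u\<^sup>2 = 0\<close>; \<open>Mk_R a b\<close> stands for \<open>a + u b\<close>.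
  The rings \<open>Z\<^sub>2\<close> and \<open>Z\<^sub>4\<close> are the types \<^typ>\<open>bit\<close> and \<^typ>\<open>4\<close>.
\<close>

datatype R = Mk_R bit bit

instantiation R :: comm_ring_1
begin

definition zero_R :: R where "0 = Mk_R 0 0"
definition one_R :: R where "1 = Mk_R 1 0"

primrec plus_R :: "R \<Rightarrow> R \<Rightarrow> R" where
  "Mk_R a b + x = (case x of Mk_R c d \<Rightarrow> Mk_R (a + c) (b + d))"

primrec uminus_R :: "R \<Rightarrow> R" where
  "- Mk_R a b = Mk_R (- a) (- b)"

definition minus_R :: "R \<Rightarrow> R \<Rightarrow> R" where "x - y = x + (- y :: R)"

primrec times_R :: "R \<Rightarrow> R \<Rightarrow> R" where
  "Mk_R a b * x = (case x of Mk_R c d \<Rightarrow> Mk_R (a * c) (a * d + b * c))"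

instance
proof
  fix a b c :: R
  show "a + b + c = a + (b + c)"
    by (cases a; cases b; cases c) (simp only: plus_R.simps R.case add.assoc)
  show "a + b = b + a"
    by (cases a; cases b) (simp only: plus_R.simps R.case add.commute)
  show "0 + a = a"
    by (cases a) (simp add: zero_R_def)
  show "- a + a = 0"
    by (cases a) (simp only: plus_R.simps uminus_R.simps R.case zero_R_def ab_left_minus)
  show "a - b = a + - b"
    by (simp only: minus_R_def)
  show "a * b * c = a * (b * c)"
    by (cases a; cases b; cases c)
      (simp only: plus_R.simps times_R.simps R.case R.inject simp_thms algebra_simps)
  show "a * b = b * a"
    by (cases a; cases b) (simp only: times_R.simps R.case ac_simps)
  show "1 * a = a"
    by (cases a) (simp add: one_R_def)
  show "(a + b) * c = a * c + b * c"
    by (cases a; cases b; cases c)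
      (simp only: plus_R.simps times_R.simps R.case R.inject simp_thms algebra_simps)
  show "(0 :: R) \<noteq> 1"
    by (simp add: zero_R_def one_R_def)
qed

end

definition uR :: R where "uR = Mk_R 0 1"

lemma uR_squared: "uR * uR = 0"
  by (simp add: uR_def zero_R_def)

lemma UNIV_R: "(UNIV :: R set) = {0, 1, uR, 1 + uR}"
proof -
  have "x \<in> {0, 1, uR, 1 + uR}" for x :: R
  proof (cases x)
    case (Mk_R a b)
    then show ?thesis
      by (cases a; cases b) (simp_all add: zero_R_def one_R_def uR_def)
  qed
  then show ?thesis by blast
qed

definition \<theta>\<^sub>R :: "R \<Rightarrow> 4" where
  "\<theta>\<^sub>R r = (if r = 0 then 0 else if r = 1 then 1 else if r = uR then 2 else 3)"

lemma \<theta>\<^sub>R_values: "\<theta>\<^sub>R 0 = 0" "\<theta>\<^sub>R 1 = 1" "\<theta>\<^sub>R uR = 2" "\<theta>\<^sub>R (1 + uR) = 3"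
  by (simp_all add: \<theta>\<^sub>R_def zero_R_def one_R_def uR_def)

text \<open>
  Vectors of length \<open>n\<close> are extensional functions on \<open>{..<n}\<close>, so that \<open>\<alpha>\<close> and \<open>\<beta>\<close> may
  be any natural numbers, including \<open>0\<close>.
\<close>

definition vecs :: "nat \<Rightarrow> (nat \<Rightarrow> 'a) set" where
  "vecs n = {..<n} \<rightarrow>\<^sub>E UNIV"

definition additive_monoid :: "('a :: ab_group_add) monoid" where
  "additive_monoid = \<lparr>carrier = UNIV, monoid.mult = (+), one = 0\<rparr>"

definition Z2Z4_group :: "nat \<Rightarrow> nat \<Rightarrow> ((nat \<Rightarrow> bit) \<times> (nat \<Rightarrow> 4)) monoid" where
  "Z2Z4_group \<alpha> \<beta> =
     product_group {..<\<alpha>} (\<lambda>_. additive_monoid) \<times>\<times> product_group {..<\<beta>} (\<lambda>_. additive_monoid)"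

definition Z2Z4_space :: "nat \<Rightarrow> nat \<Rightarrow> ((nat \<Rightarrow> bit) \<times> (nat \<Rightarrow> 4)) set" where
  "Z2Z4_space \<alpha> \<beta> = vecs \<alpha> \<times> vecs \<beta>"

definition Z2R_space :: "nat \<Rightarrow> nat \<Rightarrow> ((nat \<Rightarrow> bit) \<times> (nat \<Rightarrow> R)) set" where
  "Z2R_space \<alpha> \<beta> = vecs \<alpha> \<times> vecs \<beta>"

lemma group_additive_monoid: "group additive_monoid"
  by (rule groupI) (auto simp: additive_monoid_def add.assoc intro: exI[of _ "- _"])

lemma group_Z2Z4_group: "group (Z2Z4_group \<alpha> \<beta>)"
  by (simp add: Z2Z4_group_def DirProd_group group_additive_monoid)

lemma carrier_Z2Z4_group: "carrier (Z2Z4_group \<alpha> \<beta>) = Z2Z4_space \<alpha> \<beta>"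
  by (simp add: Z2Z4_group_def Z2Z4_space_def vecs_def additive_monoid_def)

definition Z2Z4_additive_code ::
    "nat \<Rightarrow> nat \<Rightarrow> ((nat \<Rightarrow> bit) \<times> (nat \<Rightarrow> 4)) set \<Rightarrow> bool" where
  "Z2Z4_additive_code \<alpha> \<beta> C \<longleftrightarrow> subgroup C (Z2Z4_group \<alpha> \<beta>)"

text \<open>
  \<^term>\<open>of_bit\<close> sends \<open>0, 1 \<in> Z\<^sub>2\<close> to \<open>0, 1\<close>. Into \<open>R\<close> this is the inclusion of the
  subring \<open>Z\<^sub>2\<close>. Into \<open>Z\<^sub>4\<close> it is not additive, but the factor \<open>2\<close> makes the value
  independent of the representatives chosen.
\<close>

definition inner_Z2Z4 ::
    "nat \<Rightarrow> nat \<Rightarrow> (nat \<Rightarrow> bit) \<times> (nat \<Rightarrow> 4) \<Rightarrow> (nat \<Rightarrow> bit) \<times> (nat \<Rightarrow> 4) \<Rightarrow> 4" where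
  "inner_Z2Z4 \<alpha> \<beta> = (\<lambda>(v, w) (x, y).
     2 * (\<Sum>i<\<alpha>. of_bit (v i * x i)) + (\<Sum>j<\<beta>. w j * y j))"

definition inner_Z2R ::
    "nat \<Rightarrow> nat \<Rightarrow> (nat \<Rightarrow> bit) \<times> (nat \<Rightarrow> R) \<Rightarrow> (nat \<Rightarrow> bit) \<times> (nat \<Rightarrow> R) \<Rightarrow> R" where
  "inner_Z2R \<alpha> \<beta> = (\<lambda>(v, w) (x, y).
     uR * (\<Sum>i<\<alpha>. of_bit (v i * x i)) + (\<Sum>j<\<beta>. w j * y j))"

definition Z2Z4_dual ::
    "nat \<Rightarrow> nat \<Rightarrow> ((nat \<Rightarrow> bit) \<times> (nat \<Rightarrow> 4)) set \<Rightarrow> ((nat \<Rightarrow> bit) \<times> (nat \<Rightarrow> 4)) set" where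
  "Z2Z4_dual \<alpha> \<beta> C = {z \<in> Z2Z4_space \<alpha> \<beta>. \<forall>c\<in>C. inner_Z2Z4 \<alpha> \<beta> z c = 0}"

definition Z2R_dual ::
    "nat \<Rightarrow> nat \<Rightarrow> ((nat \<Rightarrow> bit) \<times> (nat \<Rightarrow> R)) set \<Rightarrow> ((nat \<Rightarrow> bit) \<times> (nat \<Rightarrow> R)) set" where
  "Z2R_dual \<alpha> \<beta> D = {z \<in> Z2R_space \<alpha> \<beta>. \<forall>d\<in>D. inner_Z2R \<alpha> \<beta> z d = 0}"

definition Z2Z4_self_orthogonal where
  "Z2Z4_self_orthogonal \<alpha> \<beta> C \<longleftrightarrow> C \<subseteq> Z2Z4_dual \<alpha> \<beta> C"

definition Z2Z4_self_dual where
  "Z2Z4_self_dual \<alpha> \<beta> C \<longleftrightarrow> C = Z2Z4_dual \<alpha> \<beta> C"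

text \<open>
  No linearity is built into the following two notions: the preimage under \<open>\<theta>\<close> of an
  additive code need not be closed under addition.
\<close>

definition Z2R_self_orthogonal where
  "Z2R_self_orthogonal \<alpha> \<beta> D \<longleftrightarrow> D \<subseteq> Z2R_dual \<alpha> \<beta> D"

definition Z2R_self_dual where
  "Z2R_self_dual \<alpha> \<beta> D \<longleftrightarrow> D = Z2R_dual \<alpha> \<beta> D"

definition \<theta> :: "nat \<Rightarrow> (nat \<Rightarrow> bit) \<times> (nat \<Rightarrow> R) \<Rightarrow> (nat \<Rightarrow> bit) \<times> (nat \<Rightarrow> 4)" where
  "\<theta> \<beta> = (\<lambda>(v, w). (v, \<lambda>j\<in>{..<\<beta>}. \<theta>\<^sub>R (w j)))"

definition \<theta>_inverse_image ::
    "nat \<Rightarrow> nat \<Rightarrow> ((nat \<Rightarrow> bit) \<times> (nat \<Rightarrow> 4)) set \<Rightarrow> ((nat \<Rightarrow> bit) \<times> (nat \<Rightarrow> R)) set" where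
  "\<theta>_inverse_image \<alpha> \<beta> C = {z \<in> Z2R_space \<alpha> \<beta>. \<theta> \<beta> z \<in> C}"

definition N11 :: "nat \<Rightarrow> (nat \<Rightarrow> 4) \<Rightarrow> (nat \<Rightarrow> 4) \<Rightarrow> nat" where
  "N11 \<beta> w y = card {i \<in> {..<\<beta>}. w i \<in> {1, 3} \<and> y i \<in> {1, 3}}"

lemma UNIV_4: "(UNIV :: 4 set) = {0, 1, 2, 3}"
proof -
  have "card {0, 1, 2, 3 :: 4} = CARD(4)" by simp
  then show ?thesis by (metis card_subset_eq finite subset_UNIV)
qed

lemma bij_\<theta>\<^sub>R: "bij \<theta>\<^sub>R"
proof -
  have "inj \<theta>\<^sub>R"
  proof (rule injI)
    fix x y assume eq: "\<theta>\<^sub>R x = \<theta>\<^sub>R y"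
    have "x \<in> {0, 1, uR, 1 + uR}" "y \<in> {0, 1, uR, 1 + uR}"
      by (simp_all flip: UNIV_R)
    with eq show "x = y" by (auto simp: \<theta>\<^sub>R_values)
  qed
  moreover have "surj \<theta>\<^sub>R"
  proof -
    have "range \<theta>\<^sub>R = {0, 1, 2, 3}" unfolding UNIV_R by (simp add: \<theta>\<^sub>R_values)
    then show ?thesis by (simp add: UNIV_4)
  qed
  ultimately show ?thesis by (rule bijI)
qed

lemma bij_betw_\<theta>: "bij_betw (\<theta> \<beta>) (Z2R_space \<alpha> \<beta>) (Z2Z4_space \<alpha> \<beta>)"
proof (rule bij_betw_byWitness[where f' = "\<lambda>(v, w). (v, \<lambda>j\<in>{..<\<beta>}. inv_into UNIV \<theta>\<^sub>R (w j))"])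
  have *: "inv_into UNIV \<theta>\<^sub>R (\<theta>\<^sub>R r) = r" "\<theta>\<^sub>R (inv_into UNIV \<theta>\<^sub>R a) = a" for r a
    using bij_\<theta>\<^sub>R by (simp_all add: bij_is_inj bij_is_surj surj_f_inv_f)
  show "\<forall>z\<in>Z2R_space \<alpha> \<beta>. (case \<theta> \<beta> z of (v, w) \<Rightarrow> (v, \<lambda>j\<in>{..<\<beta>}. inv_into UNIV \<theta>\<^sub>R (w j))) = z"
    by (auto simp: Z2R_space_def vecs_def \<theta>_def * fun_eq_iff restrict_def PiE_def extensional_def)
  show "\<forall>z\<in>Z2Z4_space \<alpha> \<beta>. \<theta> \<beta> (case z of (v, w) \<Rightarrow> (v, \<lambda>j\<in>{..<\<beta>}. inv_into UNIV \<theta>\<^sub>R (w j))) = z"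
    by (auto simp: Z2Z4_space_def vecs_def \<theta>_def * fun_eq_iff restrict_def PiE_def extensional_def)
qed (auto simp: Z2R_space_def Z2Z4_space_def vecs_def \<theta>_def)

end

theory Submission
  imports Defs
begin

text \<open>
  Corresponding inner products over \<open>R\<close> and over \<open>\<int>\<^sub>4\<close> have the form \<open>N + u s\<close> and \<open>N + 2 s\<close> with
  the same \<open>s\<close> and with \<open>N = N\<^sub>1\<^sub>,\<^sub>1\<close>, so both vanish together once \<open>4\<close> divides \<open>N\<close>.

  For self-duality let \<open>z\<close> be orthogonal to \<open>\<theta>\<^sup>-\<^sup>1(C)\<close>. Then \<open>N(z, c)\<close> is even and equals
  \<open>\<langle>\<theta>(z), c\<rangle>\<close> modulo \<open>4\<close> for every \<open>c \<in> C\<close>; hence \<open>N(z, c) / 2\<close> modulo \<open>2\<close> is an additive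
  function of the residue of \<open>c\<close> modulo \<open>2\<close>, that is, a dot product with some \<open>e\<close>. So
  \<open>\<theta>(z) + (0 | 2e)\<close> is orthogonal to \<open>C\<close> and lies in \<open>C\<close>. It has the same units as \<open>\<theta>(z)\<close>, whence
  \<open>4\<close> divides \<open>N(z, c)\<close> and \<open>\<theta>(z)\<close> itself lies in \<open>C\<close>.
\<close>

section \<open>Linear functionals on binary vectors\<close>

text \<open>Removing the contribution of the last coordinate leaves a functional that ignores it, so
  induction on \<open>n\<close> finds the coefficients one at a time.\<close>

lemma additive_functional_bit_eq_sum:
  fixes B :: "(nat \<Rightarrow> bit) set" and g :: "(nat \<Rightarrow> bit) \<Rightarrow> bit"
  assumes closed: "\<And>a b. a \<in> B \<Longrightarrow> b \<in> B \<Longrightarrow> (\<lambda>i. a i + b i) \<in> B"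
    and add: "\<And>a b. a \<in> B \<Longrightarrow> b \<in> B \<Longrightarrow> g (\<lambda>i. a i + b i) = g a + g b"
    and local: "\<And>a b. a \<in> B \<Longrightarrow> b \<in> B \<Longrightarrow> (\<And>i. i < n \<Longrightarrow> a i = b i) \<Longrightarrow> g a = g b"
  shows "\<exists>e. \<forall>b\<in>B. g b = (\<Sum>i<n. e i * b i)"
  using add local
proof (induction n arbitrary: g)
  case 0
  \<comment> \<open>With no coordinates left, \<open>g\<close> is constant on \<open>B\<close>, so
    \<open>g b\<close> equals its value at \<open>b + b\<close>, which is
    \<open>g b + g b = 0\<close>.\<close>
  have "g b = 0" if "b \<in> B" for b
    using "0.prems"(1)[OF that that] "0.prems"(2)[OF closed[OF that that] that] by simp
  then show ?case by simp
next
  case (Suc n)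
  \<comment> \<open>\<open>e n\<close> is forced by any element of \<open>B\<close> vanishing below \<open>n\<close> but not at \<open>n\<close>;
    without such an element any value will do.\<close>
  define P where "P a \<longleftrightarrow> a \<in> B \<and> (\<forall>i<n. a i = 0) \<and> a n = 1" for a
  define t where "t = (if \<exists>a. P a then g (SOME a. P a) else 0)"
  have t: "g a = t" if "P a" for a
  proof -
    have "P (SOME a. P a)" using that someI by metis
    with that have "g a = g (SOME a. P a)"
      by (intro Suc.prems(2)) (auto simp: P_def less_Suc_eq)
    with that show ?thesis by (auto simp: t_def)
  qed
  define h where "h b = g b + t * b n" for b
  have "\<exists>e. \<forall>b\<in>B. h b = (\<Sum>i<n. e i * b i)"
  proof (rule Suc.IH)
    show "h (\<lambda>i. a i + b i) = h a + h b" if "a \<in> B" "b \<in> B" for a b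
      by (simp only: h_def Suc.prems(1)[OF that] distrib_left ac_simps)
  next
    fix a b assume ab: "a \<in> B" "b \<in> B" "\<And>i. i < n \<Longrightarrow> a i = b i"
    show "h a = h b"
    proof (cases "a n = b n")
      case True
      with ab have "g a = g b" by (intro Suc.prems(2)) (auto simp: less_Suc_eq)
      with True show ?thesis by (simp add: h_def)
    next
      \<comment> \<open>Here \<open>a + b\<close> satisfies \<open>P\<close>, so
        \<open>g a + g b = t\<close>, and the correction terms in \<open>h\<close> contribute
        exactly one more \<open>t\<close>.\<close>
      case False
      then have n: "a n + b n = 1" by (cases "a n"; cases "b n") auto
      with ab closed have "P (\<lambda>i. a i + b i)" by (auto simp: P_def)
      then have "g a + g b = t" using ab Suc.prems(1) t by metis
      moreover have "h a + h b = (g a + g b) + t * (a n + b n)"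
        by (simp only: h_def algebra_simps)
      ultimately have "h a + h b = 0" using n by simp
      then show ?thesis by (cases "h a"; cases "h b") auto
    qed
  qed
  then obtain e where e: "\<And>b. b \<in> B \<Longrightarrow> h b = (\<Sum>i<n. e i * b i)" by blast
  have "g b = (\<Sum>i<Suc n. (e(n := t)) i * b i)" if "b \<in> B" for b
  proof -
    have "g b = h b + t * b n"
      unfolding h_def by (cases "g b"; cases t; cases "b n") simp_all
    then show ?thesis using e[OF that] by simp
  qed
  then show ?case by blast
qed

section \<open>Arithmetic in \<open>4\<close> and in \<open>R\<close>\<close>

lemma cases_4: "(x :: 4) = 0 \<or> x = 1 \<or> x = 2 \<or> x = 3"
  using UNIV_4 by blast

lemma of_nat_4_eq_0_iff: "(of_nat k :: 4) = 0 \<longleftrightarrow> 4 dvd k"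
proof -
  have "(of_nat k :: 4) = of_nat (4 * (k div 4) + k mod 4)" by simp
  also have "\<dots> = (4 :: 4) * of_nat (k div 4) + of_nat (k mod 4)"
    by (simp only: of_nat_add of_nat_mult of_nat_numeral)
  also have "(4 :: 4) = 0" by simp
  finally have *: "(of_nat k :: 4) = of_nat (k mod 4)" by (simp only: mult_zero_left add_0)
  have "k mod 4 < 4" by simp
  then consider "k mod 4 = 0" | "k mod 4 = 1" | "k mod 4 = 2" | "k mod 4 = 3" by linarith
  then show ?thesis unfolding * by cases (auto simp: dvd_eq_mod_eq_0)
qed

definition residue :: "4 \<Rightarrow> bit" where
  "residue x = of_bool (x \<in> {1, 3})"

lemma residue_eq_1_iff: "residue x = 1 \<longleftrightarrow> x \<in> {1, 3}"
  by (simp add: residue_def)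

lemma residue_add: "residue (x + y) = residue x + residue y"
  using cases_4[of x] cases_4[of y] by (auto simp: residue_def)

lemma residue_double: "residue (2 * x) = 0"
  using cases_4[of x] by (auto simp: residue_def)

text \<open>Doubling in \<open>4\<close> sees only parity. A correction by
  \<open>2 * of_bit a\<close> thus contributes a product of bits.\<close>

lemma double_of_bit_mult: "2 * of_bit a * x = (2 * of_bit (a * residue x) :: 4)"
  using cases_4[of x] by (cases a) (auto simp: residue_def)

text \<open>\<open>of_bit\<close> drops the carry in \<open>1 + 1\<close>, but that carry is
  \<open>2\<close> and doubling kills it.\<close>

lemma double_of_bit_add: "2 * of_bit (a + b) = (2 * of_bit a + 2 * of_bit b :: 4)"
  by (cases a; cases b) auto

lemma double_of_bit_sum: "2 * of_bit (\<Sum>i\<in>A. f i) = (2 * (\<Sum>i\<in>A. of_bit (f i)) :: 4)"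
  by (induction A rule: infinite_finite_induct)
    (simp_all only: sum.empty sum.insert sum.infinite double_of_bit_add distrib_left
      even_zero not_True_eq_False of_bool_eq mult_zero_right simp_thms)

lemma of_nat_bit: "(of_nat m :: bit) = of_bool (odd m)"
  by (induction m) simp_all

lemma double_of_nat_add_of_bit: "2 * of_nat m + 2 * of_bit (of_nat m) = (0 :: 4)"
proof -
  have "2 * of_nat m + 2 * of_bit (of_nat m) = (of_nat (2 * m + 2 * of_bool (odd m)) :: 4)"
    by (simp add: of_nat_bit)
  also have "\<dots> = 0"
    unfolding of_nat_4_eq_0_iff by (cases "even m") (simp_all, presburger+)
  finally show ?thesis .
qed

lemma of_nat_R: "(of_nat k :: R) = Mk_R (of_nat k) 0"
  by (induction k) (simp_all add: zero_R_def one_R_def)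

lemma of_bit_R: "(of_bit a :: R) = Mk_R a 0"
  by (cases a) (simp_all add: zero_R_def one_R_def)

lemma of_bit_R_add: "(of_bit (a + b) :: R) = of_bit a + of_bit b"
  by (simp only: of_bit_R plus_R.simps R.case add_0)

lemma of_bit_R_sum: "(of_bit (\<Sum>i\<in>A. f i) :: R) = (\<Sum>i\<in>A. of_bit (f i))"
  by (induction A rule: infinite_finite_induct)
    (simp_all only: sum.empty sum.insert sum.infinite of_bit_R_add
      even_zero of_bool_eq simp_thms)

text \<open>\<open>R\<close> has characteristic \<open>2\<close>, so only the parity of
  \<open>k\<close> survives, whereas \<open>4\<close> sees \<open>k\<close> modulo
  \<open>4\<close>.\<close>

lemma of_nat_plus_uR_eq_0_iff:
  "(of_nat k + uR * of_bit s :: R) = 0 \<longleftrightarrow> even k \<and> s = 0"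
  by (cases s; cases "even k") (auto simp: of_nat_R uR_def zero_R_def one_R_def elim!: evenE oddE)

section \<open>Comparison of the two inner products\<close>

primrec u_coeff :: "R \<Rightarrow> bit" where "u_coeff (Mk_R a b) = b"

lemma R_mult_eq:
  "r * s = of_bool (\<theta>\<^sub>R r \<in> {1, 3} \<and> \<theta>\<^sub>R s \<in> {1, 3}) + uR * of_bit (u_coeff (r * s))"
proof (cases r; cases s)
  fix a b c d assume "r = Mk_R a b" "s = Mk_R c d"
  then show ?thesis
    by (cases a; cases b; cases c; cases d)
      (auto simp: \<theta>\<^sub>R_def zero_R_def one_R_def uR_def)
qed

text \<open>For bits, \<open>(a + 2 b) (c + 2 d)\<close> is \<open>a c + 2 (a d + b c)\<close>
  because \<open>4 b d\<close> vanishes, and \<open>a d + b c\<close> modulo \<open>2\<close> is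
  also the coefficient of \<open>uR\<close> in the product over \<open>R\<close>.\<close>

lemma \<theta>\<^sub>R_mult_eq:
  "\<theta>\<^sub>R r * \<theta>\<^sub>R s =
     of_bool (\<theta>\<^sub>R r \<in> {1, 3} \<and> \<theta>\<^sub>R s \<in> {1, 3}) + 2 * of_bit (u_coeff (r * s))"
proof (cases r; cases s)
  fix a b c d assume "r = Mk_R a b" "s = Mk_R c d"
  then show ?thesis
    by (cases a; cases b; cases c; cases d)
      (auto simp: \<theta>\<^sub>R_def zero_R_def one_R_def uR_def)
qed

text \<open>The target semiring is left open because the count is taken both in \<open>R\<close> and
  in \<open>4\<close>.\<close>

lemma N11_eq_sum:
  "of_nat (N11 n w y) = (\<Sum>i<n. of_bool (w i \<in> {1, 3} \<and> y i \<in> {1, 3}) :: 'a :: semiring_1)"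
  unfolding N11_def
  by (subst sum_of_bool_eq) (auto intro!: arg_cong[where f = "\<lambda>A. of_nat (card A)"])

lemma inner_\<theta>:
  assumes "\<theta> \<beta> (v, w) = (v, w')" and "\<theta> \<beta> (x, y) = (x, y')"
  obtains s where
    "inner_Z2R \<alpha> \<beta> (v, w) (x, y) = of_nat (N11 \<beta> w' y') + uR * of_bit s"
    "inner_Z2Z4 \<alpha> \<beta> (v, w') (x, y') = of_nat (N11 \<beta> w' y') + 2 * of_bit s"
proof
  \<comment> \<open>The common \<open>s\<close> is \<open>?p + ?q\<close>: the binary coordinates
    carry the factor \<open>uR\<close> or \<open>2\<close>, just as the \<open>u_coeff\<close> parts
    do.\<close>
  let ?p = "\<Sum>i<\<alpha>. v i * x i"
  let ?q = "\<Sum>j<\<beta>. u_coeff (w j * y j)"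
  have w': "w' j = \<theta>\<^sub>R (w j)" "y' j = \<theta>\<^sub>R (y j)" if "j < \<beta>" for j
    using assms that by (auto simp: \<theta>_def)
  have "(\<Sum>j<\<beta>. w j * y j) =
      (\<Sum>j<\<beta>. of_bool (w' j \<in> {1, 3} \<and> y' j \<in> {1, 3}) + uR * of_bit (u_coeff (w j * y j)))"
    by (intro sum.cong refl) (subst R_mult_eq, simp add: w')
  also have "\<dots> = of_nat (N11 \<beta> w' y') + uR * of_bit ?q"
    by (simp only: N11_eq_sum sum.distrib of_bit_R_sum sum_distrib_left)
  finally show "inner_Z2R \<alpha> \<beta> (v, w) (x, y) = of_nat (N11 \<beta> w' y') + uR * of_bit (?p + ?q)"
    by (simp only: inner_Z2R_def prod.case of_bit_R_add distrib_left ac_simps flip: of_bit_R_sum)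
  have "(\<Sum>j<\<beta>. w' j * y' j) =
      (\<Sum>j<\<beta>. of_bool (w' j \<in> {1, 3} \<and> y' j \<in> {1, 3}) + 2 * of_bit (u_coeff (w j * y j)))"
    by (intro sum.cong refl) (simp only: lessThan_iff w' \<theta>\<^sub>R_mult_eq)
  also have "\<dots> = of_nat (N11 \<beta> w' y') + 2 * of_bit ?q"
    by (simp only: N11_eq_sum sum.distrib double_of_bit_sum sum_distrib_left)
  finally show "inner_Z2Z4 \<alpha> \<beta> (v, w') (x, y') = of_nat (N11 \<beta> w' y') + 2 * of_bit (?p + ?q)"
    by (simp only: inner_Z2Z4_def prod.case double_of_bit_add ac_simps flip: double_of_bit_sum)
qed

section \<open>Sums and preimages of codewords\<close>

lemma inner_Z2Z4_add_right:
  "inner_Z2Z4 \<alpha> \<beta> z (\<lambda>i\<in>{..<\<alpha>}. x i + x' i, \<lambda>j\<in>{..<\<beta>}. y j + y' j) =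
     inner_Z2Z4 \<alpha> \<beta> z (x, y) + inner_Z2Z4 \<alpha> \<beta> z (x', y')"
proof (cases z)
  case (Pair v w)
  have "(\<Sum>i<\<alpha>. v i * (\<lambda>i\<in>{..<\<alpha>}. x i + x' i) i) = (\<Sum>i<\<alpha>. v i * x i) + (\<Sum>i<\<alpha>. v i * x' i)"
    unfolding sum.distrib[symmetric]
    by (intro sum.cong refl) (simp only: restrict_apply lessThan_iff if_True distrib_left)
  moreover have "(\<Sum>j<\<beta>. w j * (\<lambda>j\<in>{..<\<beta>}. y j + y' j) j) =
      (\<Sum>j<\<beta>. w j * y j) + (\<Sum>j<\<beta>. w j * y' j)"
    unfolding sum.distrib[symmetric]
    by (intro sum.cong refl) (simp only: restrict_apply lessThan_iff if_True distrib_left)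
  ultimately show ?thesis
    unfolding Pair inner_Z2Z4_def
    by (simp only: prod.case double_of_bit_add ac_simps flip: double_of_bit_sum)
qed

lemma Z2Z4_additive_code_add:
  assumes "Z2Z4_additive_code \<alpha> \<beta> C" "(x, y) \<in> C" "(x', y') \<in> C"
  shows "(\<lambda>i\<in>{..<\<alpha>}. x i + x' i, \<lambda>j\<in>{..<\<beta>}. y j + y' j) \<in> C"
  using subgroup.m_closed[OF assms(1)[unfolded Z2Z4_additive_code_def] assms(2,3)]
  by (simp add: Z2Z4_group_def additive_monoid_def)

lemma Z2Z4_additive_code_subset:
  assumes "Z2Z4_additive_code \<alpha> \<beta> C"
  shows "C \<subseteq> Z2Z4_space \<alpha> \<beta>"
  using assms subgroup.subset unfolding Z2Z4_additive_code_def
  by (fastforce simp flip: carrier_Z2Z4_group)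

lemma mem_\<theta>_inverse_imageE:
  assumes "c \<in> C" "C \<subseteq> Z2Z4_space \<alpha> \<beta>"
  obtains d where "d \<in> \<theta>_inverse_image \<alpha> \<beta> C" "\<theta> \<beta> d = c"
proof -
  have "c \<in> \<theta> \<beta> ` Z2R_space \<alpha> \<beta>"
    using assms bij_betw_\<theta>[of \<beta> \<alpha>] by (auto simp: bij_betw_def)
  with assms(1) that show ?thesis by (auto simp: \<theta>_inverse_image_def)
qed

lemma \<theta>_Pair: obtains w' where "\<theta> \<beta> (v, w) = (v, w')"
  by (simp add: \<theta>_def)

section \<open>Transfer of self-orthogonality\<close>

lemma self_orthogonal_\<theta>_inverse_image:
  assumes N: "\<And>v w x y. (v, w) \<in> C \<Longrightarrow> (x, y) \<in> C \<Longrightarrow> 4 dvd N11 \<beta> w y"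
    and so: "Z2Z4_self_orthogonal \<alpha> \<beta> C"
  shows "Z2R_self_orthogonal \<alpha> \<beta> (\<theta>_inverse_image \<alpha> \<beta> C)"
proof -
  have "inner_Z2R \<alpha> \<beta> (v, w) (x, y) = 0"
    if "\<theta> \<beta> (v, w) \<in> C" "\<theta> \<beta> (x, y) \<in> C" for v w x y
  proof -
    obtain w' where w': "\<theta> \<beta> (v, w) = (v, w')" by (rule \<theta>_Pair)
    obtain y' where y': "\<theta> \<beta> (x, y) = (x, y')" by (rule \<theta>_Pair)
    obtain s where s: "inner_Z2R \<alpha> \<beta> (v, w) (x, y) = of_nat (N11 \<beta> w' y') + uR * of_bit s"
      "inner_Z2Z4 \<alpha> \<beta> (v, w') (x, y') = of_nat (N11 \<beta> w' y') + 2 * of_bit s"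
      using inner_\<theta>[OF w' y'] .
    have dvd: "4 dvd N11 \<beta> w' y'" using N that w' y' by auto
    then have "even (N11 \<beta> w' y')" by (rule dvd_trans[rotated]) simp
    moreover have "inner_Z2Z4 \<alpha> \<beta> (v, w') (x, y') = 0"
      using so that w' y' by (auto simp: Z2Z4_self_orthogonal_def Z2Z4_dual_def)
    \<comment> \<open>The count vanishes in \<open>4\<close>, and then
      \<open>2 * of_bit s = 0\<close> forces \<open>s = 0\<close>.\<close>
    with dvd s(2) have "s = 0" by (cases s) (auto simp flip: of_nat_4_eq_0_iff)
    ultimately show ?thesis unfolding s(1) of_nat_plus_uR_eq_0_iff by blast
  qed
  then show ?thesis
    by (auto simp: Z2R_self_orthogonal_def Z2R_dual_def \<theta>_inverse_image_def)
qed

section \<open>Transfer of self-duality\<close>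

lemma Z2R_dual_\<theta>_inverse_image_subset:
  assumes code: "Z2Z4_additive_code \<alpha> \<beta> C"
    and N: "\<And>v w x y. (v, w) \<in> C \<Longrightarrow> (x, y) \<in> C \<Longrightarrow> 4 dvd N11 \<beta> w y"
    and dual: "Z2Z4_dual \<alpha> \<beta> C \<subseteq> C"
  shows "Z2R_dual \<alpha> \<beta> (\<theta>_inverse_image \<alpha> \<beta> C) \<subseteq> \<theta>_inverse_image \<alpha> \<beta> C"
proof
  fix z assume z: "z \<in> Z2R_dual \<alpha> \<beta> (\<theta>_inverse_image \<alpha> \<beta> C)"
  obtain v w where vw: "z = (v, w)" by (cases z)
  obtain w' where w': "\<theta> \<beta> (v, w) = (v, w')" by (rule \<theta>_Pair)
  have z_space: "(v, w') \<in> Z2Z4_space \<alpha> \<beta>"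
    using z vw w' bij_betw_\<theta>[of \<beta> \<alpha>]
    by (metis (no_types, lifting) Z2R_dual_def bij_betwE mem_Collect_eq)
  have ev: "even (N11 \<beta> w' y)" and inner: "inner_Z2Z4 \<alpha> \<beta> (v, w') (x, y) = of_nat (N11 \<beta> w' y)"
    if c: "(x, y) \<in> C" for x y
  proof -
    \<comment> \<open>Every codeword has a preimage orthogonal to \<open>z\<close>; the vanishing
      product over \<open>R\<close> makes the count even and \<open>s\<close> zero.\<close>
    obtain d where d: "d \<in> \<theta>_inverse_image \<alpha> \<beta> C" "\<theta> \<beta> d = (x, y)"
      using mem_\<theta>_inverse_imageE[OF c Z2Z4_additive_code_subset[OF code]] .
    then obtain y0 where y0: "d = (x, y0)" by (cases d) (auto simp: \<theta>_def)
    obtain s where s: "inner_Z2R \<alpha> \<beta> (v, w) (x, y0) = of_nat (N11 \<beta> w' y) + uR * of_bit s"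
      "inner_Z2Z4 \<alpha> \<beta> (v, w') (x, y) = of_nat (N11 \<beta> w' y) + 2 * of_bit s"
      using inner_\<theta>[OF w' d(2)[unfolded y0]] .
    have "inner_Z2R \<alpha> \<beta> (v, w) (x, y0) = 0"
      using z d y0 vw by (auto simp: Z2R_dual_def)
    then have "even (N11 \<beta> w' y) \<and> s = 0" unfolding s(1) of_nat_plus_uR_eq_0_iff .
    with s(2) show "even (N11 \<beta> w' y)" "inner_Z2Z4 \<alpha> \<beta> (v, w') (x, y) = of_nat (N11 \<beta> w' y)"
      by auto
  qed
  \<comment> \<open>Coordinates from \<beta> on are left free, so that \<open>B\<close> is closed
    under sums of unrestricted sequences.\<close>
  define B where "B = {b. \<exists>x y. (x, y) \<in> C \<and> (\<forall>i<\<beta>. b i = residue (y i))}"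
  \<comment> \<open>Counting through residues makes \<open>N11\<close> a function of the bit vector,
    with no codeword to choose.\<close>
  define M where "M b = card {i \<in> {..<\<beta>}. w' i \<in> {1, 3} \<and> b i = 1}" for b :: "nat \<Rightarrow> bit"
  \<comment> \<open>The halving is exact on \<open>B\<close>, where \<open>M\<close> is
    even.\<close>
  define g :: "(nat \<Rightarrow> bit) \<Rightarrow> bit" where "g b = of_nat (M b div 2)" for b
  have M_local: "M a = M b" if "\<And>i. i < \<beta> \<Longrightarrow> a i = b i" for a b
    using that unfolding M_def by (intro arg_cong[where f = card]) auto
  have M: "M b = N11 \<beta> w' y" if "\<And>i. i < \<beta> \<Longrightarrow> b i = residue (y i)" for b y
    using that unfolding M_def N11_def
    by (intro arg_cong[where f = card]) (auto simp: residue_eq_1_iff)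
  have "\<exists>e. \<forall>b\<in>B. g b = (\<Sum>i<\<beta>. e i * b i)"
  proof (rule additive_functional_bit_eq_sum)
    fix a b assume "a \<in> B" "b \<in> B"
    then obtain x y x' y' where c: "(x, y) \<in> C" "(x', y') \<in> C"
      and a: "\<And>i. i < \<beta> \<Longrightarrow> a i = residue (y i)" and b: "\<And>i. i < \<beta> \<Longrightarrow> b i = residue (y' i)"
      unfolding B_def by blast
    let ?x = "\<lambda>i\<in>{..<\<alpha>}. x i + x' i" and ?y = "\<lambda>j\<in>{..<\<beta>}. y j + y' j"
    have c': "(?x, ?y) \<in> C" using Z2Z4_additive_code_add[OF code c] .
    have ab: "a i + b i = residue (?y i)" if "i < \<beta>" for i
      using that a b by (simp add: residue_add)
    show "(\<lambda>i. a i + b i) \<in> B" unfolding B_def using c' ab by blast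
    obtain k l m where k: "N11 \<beta> w' y = 2 * k" and l: "N11 \<beta> w' y' = 2 * l"
      and m: "N11 \<beta> w' ?y = 2 * m"
      using ev[OF c(1)] ev[OF c(2)] ev[OF c'] by (elim evenE)
    have *: "(of_nat (2 * m) :: 4) = of_nat (2 * k) + of_nat (2 * l)"
      using inner_Z2Z4_add_right[of \<alpha> \<beta> "(v, w')" x x' y y']
      unfolding inner[OF c(1)] inner[OF c(2)] inner[OF c'] k l m .
    \<comment> \<open>Adding \<open>2 k + 2 l\<close> to both sides avoids subtraction and shows
      that \<open>m + k + l\<close> is even.\<close>
    have "(of_nat (2 * (m + k + l)) :: 4) = of_nat (2 * m) + (of_nat (2 * k) + of_nat (2 * l))"
      by (simp only: of_nat_add distrib_left add.assoc)
    also have "\<dots> = of_nat (2 * k) + of_nat (2 * l) + (of_nat (2 * k) + of_nat (2 * l))"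
      unfolding * ..
    also have "\<dots> = of_nat (4 * (k + l))" by (simp flip: of_nat_add of_nat_mult)
    also have "\<dots> = 0" unfolding of_nat_4_eq_0_iff by simp
    finally have "(of_nat (2 * (m + k + l)) :: 4) = 0" .
    then have "even (m + k + l)" unfolding of_nat_4_eq_0_iff by presburger
    then have "(of_nat m :: bit) = of_nat k + of_nat l" by (auto simp: of_nat_bit)
    moreover have "M a = 2 * k" "M b = 2 * l" "M (\<lambda>i. a i + b i) = 2 * m"
      using M[OF a] M[OF b] M[of "\<lambda>i. a i + b i" ?y, OF ab] k l m by simp_all
    ultimately show "g (\<lambda>i. a i + b i) = g a + g b"
      unfolding g_def by (simp only: nonzero_mult_div_cancel_left[of "2 :: nat"] numeral_neq_zero
          simp_thms)
  next
    show "g a = g b" if "\<And>i. i < \<beta> \<Longrightarrow> a i = b i" for a b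
      using M_local[OF that] by (simp add: g_def)
  qed
  then obtain e where e: "\<And>b. b \<in> B \<Longrightarrow> g b = (\<Sum>i<\<beta>. e i * b i)" by blast
  define q where "q = (\<lambda>j\<in>{..<\<beta>}. w' j + 2 * of_bit (e j))"
  have "inner_Z2Z4 \<alpha> \<beta> (v, q) (x, y) = 0" if c: "(x, y) \<in> C" for x y
  proof -
    obtain k where k: "N11 \<beta> w' y = 2 * k" using ev[OF c] by (elim evenE)
    have "(\<lambda>i. residue (y i)) \<in> B" using c by (auto simp: B_def)
    from e[OF this] have k_eq: "of_nat k = (\<Sum>j<\<beta>. e j * residue (y j))"
      unfolding g_def M[OF refl] k by simp
    have "(\<Sum>j<\<beta>. q j * y j) = (\<Sum>j<\<beta>. w' j * y j) + (\<Sum>j<\<beta>. 2 * of_bit (e j) * y j)"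
      unfolding q_def sum.distrib[symmetric] by (intro sum.cong) (auto simp: distrib_right)
    \<comment> \<open>Pairing \<open>2 e\<close> with \<open>y\<close> gives twice the functional at
      the residue of \<open>y\<close>; this cancels the count \<open>2 * k\<close>.\<close>
    also have "(\<Sum>j<\<beta>. 2 * of_bit (e j) * y j) = 2 * of_bit (of_nat k)"
      unfolding k_eq double_of_bit_sum double_of_bit_mult sum_distrib_left ..
    finally have "inner_Z2Z4 \<alpha> \<beta> (v, q) (x, y) =
        inner_Z2Z4 \<alpha> \<beta> (v, w') (x, y) + 2 * of_bit (of_nat k)"
      by (simp add: inner_Z2Z4_def add.assoc)
    then show ?thesis
      unfolding inner[OF c] k using double_of_nat_add_of_bit[of k] by simp
  qed
  moreover have "(v, q) \<in> Z2Z4_space \<alpha> \<beta>"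
    using z_space by (auto simp: Z2Z4_space_def vecs_def q_def)
  ultimately have q: "(v, q) \<in> C" using dual by (auto simp: Z2Z4_dual_def)
  have res: "residue (q j) = residue (w' j)" if "j < \<beta>" for j
    using that by (simp add: q_def residue_add residue_double)
  have "inner_Z2Z4 \<alpha> \<beta> (v, w') (x, y) = 0" if c: "(x, y) \<in> C" for x y
  proof -
    \<comment> \<open>The divisibility hypothesis concerns pairs of codewords, and
      \<open>(v, w')\<close> is not yet known to be one; \<open>(v, q)\<close> is, with the same
      units.\<close>
    have "N11 \<beta> w' y = N11 \<beta> q y"
      using res unfolding N11_def residue_eq_1_iff[symmetric]
      by (intro arg_cong[where f = card]) auto
    with N[OF q c] show ?thesis unfolding inner[OF c] of_nat_4_eq_0_iff by simp
  qed
  with z_space dual have "(v, w') \<in> C" by (auto simp: Z2Z4_dual_def)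
  with z w' vw show "z \<in> \<theta>_inverse_image \<alpha> \<beta> C"
    by (auto simp: \<theta>_inverse_image_def Z2R_dual_def)
qed

theorem theorem3p4:
  fixes \<alpha> \<beta> :: nat and C :: "((nat \<Rightarrow> bit) \<times> (nat \<Rightarrow> 4)) set"
  assumes "Z2Z4_additive_code \<alpha> \<beta> C"
    and "\<And>v w x y. (v, w) \<in> C \<Longrightarrow> (x, y) \<in> C \<Longrightarrow> 4 dvd N11 \<beta> w y"
  shows "(Z2Z4_self_orthogonal \<alpha> \<beta> C \<longrightarrow> Z2R_self_orthogonal \<alpha> \<beta> (\<theta>_inverse_image \<alpha> \<beta> C))
       \<and> (Z2Z4_self_dual \<alpha> \<beta> C \<longrightarrow> Z2R_self_dual \<alpha> \<beta> (\<theta>_inverse_image \<alpha> \<beta> C))"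
proof (intro conjI impI)
  show orth: "Z2R_self_orthogonal \<alpha> \<beta> (\<theta>_inverse_image \<alpha> \<beta> C)"
    if "Z2Z4_self_orthogonal \<alpha> \<beta> C"
    using assms(2) that by (rule self_orthogonal_\<theta>_inverse_image)
  assume "Z2Z4_self_dual \<alpha> \<beta> C"
  then have "Z2Z4_self_orthogonal \<alpha> \<beta> C" and dual: "Z2Z4_dual \<alpha> \<beta> C \<subseteq> C"
    by (simp_all add: Z2Z4_self_dual_def Z2Z4_self_orthogonal_def)
  with orth Z2R_dual_\<theta>_inverse_image_subset[OF assms dual]
  show "Z2R_self_dual \<alpha> \<beta> (\<theta>_inverse_image \<alpha> \<beta> C)"
    by (auto simp: Z2R_self_dual_def Z2R_self_orthogonal_def)
qed

end
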